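(* Let $P,Q\in\mathbb{Z}[n]$ be polynomials with positive leading coefficient and zero constant term, and suppose $P\neq Q$. Then: (1) If $\max\{\deg P,\deg Q\}>1$, there exists a $2$-coloring $\phi:\mathbb{N}\to\{1,2\}$ such that for any $i\in\{1,2\}$ and any $n\in\mathbb{N}$, the set $\{m\in\mathbb{N}:\phi(n+P(m))=\phi(n+Q(m))=i\}$ is empty or finite. (2) If $\deg P=\deg Q=1$, there exists a $3$-coloring $\phi:\mathbb{N}\to\{1,2,3\}$ such that for any $i\in\{1,2,3\}$ and any $n\in\mathbb{N}$, the set $\{m\in\mathbb{N}:\phi(n+P(m))=\phi(n+Q(m))=i\}$ is empty or finite. (3) If $\deg P=\deg Q=1$, there exists a $2$-coloring $\phi:\mathbb{N}\to\{1,2\}$ such that for any $i\in\{1,2\}$, there do not exist two infinite subsets $B,C\subset\mathbb{N}$ such that $\phi$ takes the constant value $i$ on $(B+P(C))\cup(B+Q(C))$.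
   Context: $\mathbb{N}=\{1,2,3,\ldots\}$. For $B,C\subset\mathbb{N}$ and a polynomial $P$, $B+P(C)=\{b+P(c):b\in B,c\in C\}$. In the sets $\{m\in\mathbb{N}:\phi(n+P(m))=\phi(n+Q(m))=i\}$, the condition is understood to include that $n+P(m)$ and $n+Q(m)$ both lie in $\mathbb{N}$ (this fails for at most finitely many $m$, since $P,Q$ have positive leading coefficients and positive degree). *)

theory Defs
  imports "HOL-Computational_Algebra.Polynomial" "HOL-Library.Set_Algebras"
begin

text \<open>
  The set of positive integers, taken inside \<^typ>\<open>int\<close> so that polynomials with
  integer coefficients can be evaluated without coercions. Colorings are total functions on
  \<^typ>\<open>int\<close> of which only the values on this set matter. For sets \<open>B\<close>, \<open>C\<close> the sumset
  \<open>B + P(C)\<close> is \<open>B + poly P ` C\<close>, the elementwise sum of sets.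
\<close>
definition posints :: "int set" where
  "posints = {n. n \<ge> 1}"

definition is_coloring :: "nat \<Rightarrow> (int \<Rightarrow> nat) \<Rightarrow> bool" where
  "is_coloring r \<phi> \<longleftrightarrow> (\<forall>n\<in>posints. \<phi> n \<in> {1..r})"

text \<open>
  \<open>P\<close> and \<open>Q\<close> may take negative values, so membership of \<open>n + P(m)\<close> and
  \<open>n + Q(m)\<close> in the domain of the coloring is part of the condition.
\<close>
definition mono_set :: "(int \<Rightarrow> nat) \<Rightarrow> int poly \<Rightarrow> int poly \<Rightarrow> int \<Rightarrow> nat \<Rightarrow> int set" where
  "mono_set \<phi> P Q n i =
     {m \<in> posints. n + poly P m \<in> posints \<and> n + poly Q m \<in> posints \<and>
        \<phi> (n + poly P m) = i \<and> \<phi> (n + poly Q m) = i}"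

end

theory Submission
  imports Defs
begin

text \<open>
  After possibly exchanging \<open>P\<close> and \<open>Q\<close>, assume that \<open>Q(m) < P(m)\<close> for large \<open>m\<close>.

  Suppose first that the larger polynomial \<open>P\<close> is nonlinear. The gaps \<open>P(m+1) - P(m)\<close> tend to
  infinity, so for fixed \<open>n\<close> and all large \<open>m\<close> the point \<open>n + P(m)\<close> lies in the interval
  \<open>(P(m), P(m+1)]\<close>, and this interval determines \<open>m\<close>. Every \<open>x\<close> therefore has at most one partner
  \<open>x - P(m) + Q(m)\<close> from which it has to differ, and the partner is smaller. A 2-coloring is
  obtained by recursion, giving each point the color opposite to that of its partner
  (lemmas \<open>flip_coloring_separates\<close> and \<open>separating_two_coloring\<close>).

  If \<open>P(m) = a m\<close> and \<open>Q(m) = b m\<close> with \<open>a > b\<close>, the intervals have bounded length and this breaks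
  down; instead the color of \<open>x\<close> is \<open>\<lfloor>log t x\<rfloor>\<close> modulo the number of colors. The quotient
  \<open>(n + a m) / (n + b m)\<close> stays below \<open>a / b\<close> and converges to it. With three colors, choose the base
  so that \<open>t < a/b < t\<^sup>2\<close>: eventually the two logarithms differ by at least 1 and less than 2, so
  their floors differ by 1 or 2, hence differ modulo 3. With two colors, take the base \<open>t = a/b\<close>.
  The logarithms then differ by less than 1, so equal colors mean that no power of \<open>t\<close> separates
  \<open>n + b m\<close> from \<open>n + a m\<close>; this forces \<open>b m\<close> into a window just below a power of \<open>t\<close>, at a distance
  between \<open>n b/a\<close> and \<open>n\<close>. For \<open>n' > n a/b\<close> the windows belonging to \<open>n\<close> and to \<open>n'\<close> are disjoint, so
  two elements of \<open>B\<close> that are far enough apart exclude all large elements of \<open>C\<close>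
  (lemma \<open>no_large_common_shift\<close>).
\<close>

section \<open>Growth of integer polynomials\<close>

lemma poly_eventually_pos:
  fixes p :: "int poly"
  assumes "lead_coeff p > 0"
  shows "eventually (\<lambda>x. poly p x > 0) at_top"
  using assms
proof (induction p)
  case 0
  then show ?case by simp
next
  case (pCons a q)
  show ?case
  proof (cases "q = 0")
    case True
    with pCons.prems show ?thesis by simp
  next
    case False
    with pCons have "eventually (\<lambda>x. poly q x > 0) at_top" by simp
    moreover have "eventually (\<lambda>x. x > \<bar>a\<bar>) at_top"
      by (rule eventually_gt_at_top)
    ultimately show ?thesis
    proof eventually_elim
      case (elim x)
      then have "x * 1 \<le> x * poly q x"
        by (intro mult_left_mono) auto
      with elim show ?case by simp
    qed
  qed
qed

lemma poly_eventually_ge: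
  fixes p :: "int poly"
  assumes "lead_coeff p > 0" "degree p > 0"
  shows "eventually (\<lambda>x. poly p x \<ge> K) at_top"
proof -
  have "lead_coeff ([:1 - K:] + p) = lead_coeff p"
    using assms(2) by (intro lead_coeff_add_le) simp
  with assms(1) have "eventually (\<lambda>x. poly ([:1 - K:] + p) x > 0) at_top"
    by (intro poly_eventually_pos) simp
  then show ?thesis
    by eventually_elim simp
qed

lemma eventually_at_top_succ:
  fixes R :: "int \<Rightarrow> bool"
  assumes "eventually R at_top"
  shows "eventually (\<lambda>x. R (x + 1)) at_top"
proof -
  from assms obtain N where "\<forall>x\<ge>N. R x" by (auto simp: eventually_at_top_linorder)
  then show ?thesis unfolding eventually_at_top_linorder by (intro exI[of _ N]) simp
qed

lemma poly_pCons_diff: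
  fixes q :: "int poly"
  shows "poly (pCons a q) (x + 1) - poly (pCons a q) x
    = poly q (x + 1) + x * (poly q (x + 1) - poly q x)"
  by (simp add: algebra_simps)

text \<open>
  Induction on the coefficients avoids computing the degree and the leading coefficient of the
  difference polynomial: for \<open>p = a + x q\<close> the difference of \<open>p\<close> is \<open>q(x+1)\<close> plus \<open>x\<close> times the
  difference of \<open>q\<close>, and both terms are eventually nonnegative.
\<close>
lemma poly_eventually_incseq:
  fixes p :: "int poly"
  assumes "lead_coeff p > 0"
  shows "eventually (\<lambda>x. poly p (x + 1) - poly p x \<ge> 0) at_top"
  using assms
proof (induction p)
  case 0
  then show ?case by simp
next
  case (pCons a q)
  show ?case
  proof (cases "q = 0")
    case True
    then show ?thesis by simp
  next
    case False
    with pCons have "lead_coeff q > 0" by simp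
    from eventually_at_top_succ[OF poly_eventually_pos[OF this]] pCons.IH[OF this]
      eventually_ge_at_top[of 0]
    show ?thesis
    proof eventually_elim
      case (elim x)
      then show ?case unfolding poly_pCons_diff by simp
    qed
  qed
qed

text \<open>
  In the same decomposition \<open>q\<close> is now nonconstant, so that the term \<open>q(x+1)\<close> alone exceeds every
  bound, while the other term stays nonnegative.
\<close>
lemma poly_gaps_unbounded:
  fixes p :: "int poly"
  assumes "lead_coeff p > 0" "degree p > 1"
  shows "eventually (\<lambda>x. poly p (x + 1) - poly p x \<ge> K) at_top"
proof -
  obtain a q where p: "p = pCons a q" by (rule pCons_cases)
  with assms have q: "lead_coeff q > 0" "degree q > 0" by (auto split: if_splits)
  from eventually_at_top_succ[OF poly_eventually_ge[OF q, of K]]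
    poly_eventually_incseq[OF q(1)] eventually_ge_at_top[of 0]
  show ?thesis
  proof eventually_elim
    case (elim x)
    then have "x * (poly q (x + 1) - poly q x) \<ge> 0" by simp
    with elim show ?case unfolding p poly_pCons_diff by linarith
  qed
qed

section \<open>Monochromatic sets\<close>

text \<open>The symmetry that allows the larger of the two polynomials to be named \<open>P\<close>.\<close>
lemma mono_set_commute: "mono_set \<phi> P Q n i = mono_set \<phi> Q P n i"
  by (auto simp: mono_set_def)

lemma finite_mono_setI:
  assumes "eventually (\<lambda>m. \<phi> (n + poly P m) \<noteq> \<phi> (n + poly Q m)) at_top"
  shows "finite (mono_set \<phi> P Q n i)"
proof -
  from assms obtain N where N: "\<And>m. m \<ge> N \<Longrightarrow> \<phi> (n + poly P m) \<noteq> \<phi> (n + poly Q m)"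
    by (auto simp: eventually_at_top_linorder)
  have "mono_set \<phi> P Q n i \<subseteq> {1..N}"
  proof
    fix m assume "m \<in> mono_set \<phi> P Q n i"
    then have "m \<ge> 1" "\<phi> (n + poly P m) = \<phi> (n + poly Q m)"
      by (simp_all add: mono_set_def posints_def)
    with N[of m] show "m \<in> {1..N}" by force
  qed
  then show ?thesis by (rule finite_subset) simp
qed

section \<open>Two colors for widely spaced shifts\<close>

text \<open>
  A point \<open>x\<close> is constrained by its partner \<open>h x\<close>. The guard makes the recursion descend through
  the positive integers; points at which it fails are unconstrained and get color 1.
\<close>
function flip_coloring :: "(int \<Rightarrow> int) \<Rightarrow> int \<Rightarrow> nat" where
  "flip_coloring h x = (if 0 < h x \<and> h x < x then 3 - flip_coloring h (h x) else 1)"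
  by auto
termination by (relation "measure (\<lambda>(h, x). nat x)") auto

declare flip_coloring.simps [simp del]

lemma flip_coloring_range: "flip_coloring h x \<in> {1..2}"
proof (induction h x rule: flip_coloring.induct)
  case (1 h x)
  then show ?case by (subst flip_coloring.simps) auto
qed

lemma flip_coloring_separates:
  assumes "0 < h x" "h x < x"
  shows "flip_coloring h x \<noteq> flip_coloring h (h x)"
proof -
  have "flip_coloring h x = 3 - flip_coloring h (h x)"
    using assms by (subst flip_coloring.simps) simp
  then show ?thesis
    using flip_coloring_range[of h "h x"] by presburger
qed

text \<open>
  Polynomials enter only through three growth properties. The unbounded gaps of \<open>p\<close> ensure both
  that a fixed \<open>n\<close> eventually fits into each gap and that the point \<open>n + p m\<close> reveals \<open>m\<close>, so
  that no point is asked to differ from two others.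
\<close>
lemma separating_two_coloring:
  fixes p q :: "int \<Rightarrow> int"
  assumes gaps: "\<And>K. eventually (\<lambda>m. p (m + 1) - p m \<ge> K) at_top"
    and less: "eventually (\<lambda>m. q m < p m) at_top"
    and nonneg: "eventually (\<lambda>m. q m \<ge> 0) at_top"
  shows "\<exists>\<phi>. is_coloring 2 \<phi> \<and>
    (\<forall>n\<in>posints. eventually (\<lambda>m. \<phi> (n + p m) \<noteq> \<phi> (n + q m)) at_top)"
proof -
  have "eventually (\<lambda>m. p (m + 1) - p m \<ge> 0 \<and> q m < p m \<and> q m \<ge> 0) at_top"
    using gaps less nonneg by (intro eventually_conj)
  then obtain M where M: "\<And>m. m \<ge> M \<Longrightarrow> p m \<le> p (m + 1) \<and> q m < p m \<and> q m \<ge> 0"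
    by (auto simp: eventually_at_top_linorder)
  have mono: "p m \<le> p m'" if "M \<le> m" "m \<le> m'" for m m'
    using that(2)
  proof (induction m' rule: int_ge_induct)
    case (step k)
    then show ?case using M[of k] that(1) by simp
  qed simp
  (* loc m x: the gap above p m contains x; the half-open gaps are pairwise disjoint. *)
  define loc where "loc m x \<longleftrightarrow> m \<ge> M \<and> p m < x \<and> x \<le> p (m + 1)" for m x
  have loc_unique: "m = m'" if "loc m x" "loc m' x" for m m' x
    using that mono[of "m + 1" m'] mono[of "m' + 1" m] unfolding loc_def by linarith
  (* For x in the gap above p m this is the partner x - p m + q m. Elsewhere the value is arbitrary:
     for fixed n, the point n + p m lies in the gap above p m once m is large. *)
  define h where "h x = x - p (THE m. loc m x) + q (THE m. loc m x)" for x
  have "eventually (\<lambda>m. flip_coloring h (n + p m) \<noteq> flip_coloring h (n + q m)) at_top"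
    if "n \<in> posints" for n
    using gaps[of n] eventually_ge_at_top[of M]
  proof eventually_elim
    case (elim m)
    have n: "n \<ge> 1" using that by (simp add: posints_def)
    with elim have "loc m (n + p m)" by (simp add: loc_def)
    then have "(THE m'. loc m' (n + p m)) = m"
      using loc_unique by (intro the_equality)
    then have h: "h (n + p m) = n + q m" by (simp add: h_def)
    show ?case
      using flip_coloring_separates[of h "n + p m"] M[OF elim(2)] n unfolding h by simp
  qed
  moreover have "is_coloring 2 (flip_coloring h)"
    using flip_coloring_range by (simp add: is_coloring_def)
  ultimately show ?thesis by blast
qed

text \<open>
  The eventually larger polynomial is the one whose gaps must grow. It is nonlinear because it
  dominates the other one and at least one of the two is nonlinear.
\<close>
lemma nonlinear_two_coloring:
  assumes "lead_coeff P > 0" "lead_coeff Q > 0" "degree Q > 0"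
    and "max (degree P) (degree Q) > 1" and dom: "lead_coeff (P - Q) > 0"
  shows "\<exists>\<phi>. is_coloring 2 \<phi> \<and> (\<forall>n\<in>posints. \<forall>i. finite (mono_set \<phi> P Q n i))"
proof -
  have "degree P > 1"
  proof (rule ccontr)
    assume "\<not> degree P > 1"
    with assms(4) have "degree P < degree (- Q)" by simp
    then have "lead_coeff (P + - Q) = lead_coeff (- Q)" by (rule lead_coeff_add_le)
    with dom \<open>lead_coeff Q > 0\<close> show False by simp
  qed
  have "eventually (\<lambda>m. poly Q m < poly P m) at_top"
    using poly_eventually_pos[OF dom] by eventually_elim simp
  from separating_two_coloring[OF poly_gaps_unbounded[OF assms(1) \<open>degree P > 1\<close>] this
      poly_eventually_ge[OF assms(2,3)]]
  show ?thesis using finite_mono_setI by blast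
qed

section \<open>Logarithmic colorings for linear shifts\<close>

text \<open>The successive color classes are the intervals between consecutive powers of \<open>t\<close>, repeating
  cyclically; adding 1 moves the residues into \<open>{1..r}\<close>.\<close>
definition log_coloring :: "real \<Rightarrow> nat \<Rightarrow> int \<Rightarrow> nat" where
  "log_coloring t r x = nat (\<lfloor>log t (real_of_int x)\<rfloor> mod int r) + 1"

lemma is_coloring_log_coloring:
  assumes "r > 0"
  shows "is_coloring r (log_coloring t r)"
proof -
  have "nat (k mod int r) + 1 \<le> r" for k
    using assms pos_mod_bound[of "int r" k] by linarith
  then show ?thesis by (simp add: is_coloring_def log_coloring_def)
qed

lemma log_coloring_eq_iff:
  assumes "r > 0"
  shows "log_coloring t r x = log_coloring t r y \<longleftrightarrow>
    \<lfloor>log t (real_of_int x)\<rfloor> mod int r = \<lfloor>log t (real_of_int y)\<rfloor> mod int r"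
  using assms by (simp add: log_coloring_def nat_eq_iff)

text \<open>
  For a base \<open>t\<close> with \<open>t < a/b < t\<^sup>2\<close>, the points \<open>n + b m\<close> and \<open>n + a m\<close> are eventually between
  one and two color intervals apart, so their interval indices differ by 1 or 2. The quotient of
  the points stays below \<open>a/b\<close>, hence below \<open>t\<^sup>2\<close>, for every \<open>m\<close>; only the lower bound \<open>t\<close> needs
  \<open>m\<close> to be large.
\<close>
lemma linear_three_coloring:
  fixes a b :: int
  assumes "0 < b" "b < a"
  shows "\<exists>\<phi>. is_coloring 3 \<phi> \<and> (\<forall>n\<in>posints. \<forall>i. finite (mono_set \<phi> [:0, a:] [:0, b:] n i))"
proof -
  define r where "r = real_of_int a / real_of_int b"
  have r: "r > 1" and a: "real_of_int a = r * real_of_int b"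
    using assms by (simp_all add: r_def)
  have "sqrt r < r"
    using r by (simp add: real_less_lsqrt power2_eq_square)
  then obtain t where t: "sqrt r < t" "t < r" using dense by blast
  have "sqrt r > 1" using r by simp
  with t(1) have t1: "t > 1" by linarith
  have "(sqrt r)\<^sup>2 < t\<^sup>2" using t(1) r by (intro power_strict_mono) auto
  then have rt: "r < t\<^sup>2" using r by simp
  have "finite (mono_set (log_coloring t 3) [:0, a:] [:0, b:] n i)" if "n \<in> posints" for n i
  proof (rule finite_mono_setI)
    have n: "n \<ge> 1" using that by (simp add: posints_def)
    (* The condition t * (n + b * m) <= n + a * m follows from t * n <= (r - t) * b * m. *)
    define N where "N = max 1 \<lceil>t * n / ((r - t) * b)\<rceil>"
    show "eventually (\<lambda>m. log_coloring t 3 (n + poly [:0, a:] m) \<noteq>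
        log_coloring t 3 (n + poly [:0, b:] m)) at_top"
      using eventually_ge_at_top[of N]
    proof eventually_elim
      case (elim m)
      define x where "x = real_of_int n + b * m"
      define y where "y = real_of_int n + a * m"
      have m: "m \<ge> 1" "real_of_int m \<ge> t * n / ((r - t) * b)"
        using elim by (auto simp: N_def ceiling_le_iff)
      have bm: "real_of_int b * m > 0" using m(1) assms by simp
      have x0: "x > 0" using bm n by (simp add: x_def)
      have "(r - t) * b > 0" using t assms by simp
      then have "t * n \<le> real_of_int m * ((r - t) * b)"
        using m(2) by (simp add: pos_divide_le_eq)
      then have lower: "t * x \<le> y"
        using n unfolding x_def y_def by (simp add: a algebra_simps)
      have "y \<le> r * x"
        using n r unfolding x_def y_def by (simp add: a algebra_simps)
      also have "\<dots> < t\<^sup>2 * x" using rt x0 by simp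
      finally have upper: "y < t\<^sup>2 * x" .
      have y0: "y > 0" using lower mult_pos_pos[of t x] x0 t1 by linarith
      have "log t (t * x) \<le> log t y"
        using lower x0 t1 y0 by simp
      then have l: "1 + log t x \<le> log t y" using x0 t1 by (simp add: log_mult)
      have "log t y < log t (t\<^sup>2 * x)"
        using upper x0 t1 y0 by simp
      then have u: "log t y < 2 + log t x" using x0 t1 by (simp add: log_mult log_nat_power)
      have "\<lfloor>log t y\<rfloor> - \<lfloor>log t x\<rfloor> \<in> {1, 2}"
        using l u by simp linarith
      then have "\<lfloor>log t y\<rfloor> mod 3 \<noteq> \<lfloor>log t x\<rfloor> mod 3"
        by simp presburger
      then show ?case
        by (simp add: log_coloring_eq_iff x_def y_def mult.commute)
    qed
  qed
  then show ?thesis using is_coloring_log_coloring[of 3 t] by auto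
qed

text \<open>
  In base \<open>a/b\<close> the two logarithms differ by less than 1, since the summand \<open>n > 0\<close> pulls the quotient
  below \<open>a/b\<close>. The floors then differ by at most 1, and equal parity forces equality.
\<close>
lemma log_coloring_same_floor:
  fixes a b n c :: int
  assumes "0 < b" "b < a" "n \<ge> 1" "c \<ge> 1"
    and same: "log_coloring (a / b) 2 (n + a * c) = log_coloring (a / b) 2 (n + b * c)"
  shows "\<lfloor>log (a / b) (real_of_int (n + a * c))\<rfloor> = \<lfloor>log (a / b) (real_of_int (n + b * c))\<rfloor>"
proof -
  define t where "t = real_of_int a / real_of_int b"
  have t: "t > 1" and a: "real_of_int a = t * real_of_int b"
    using assms by (simp_all add: t_def)
  define x where "x = real_of_int (n + b * c)"
  define y where "y = real_of_int (n + a * c)"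
  have "real_of_int b * c > 0" using assms by simp
  then have x0: "x > 0" using \<open>n \<ge> 1\<close> by (simp add: x_def add_pos_pos)
  have xy: "x < y" using assms by (simp add: x_def y_def)
  have yx: "y < t * x"
    using t \<open>n \<ge> 1\<close> unfolding x_def y_def by (simp add: a algebra_simps)
  have "log t x < log t y" using t x0 xy by simp
  moreover have "log t y < log t (t * x)" using t x0 xy yx by simp
  then have "log t y < 1 + log t x" using t x0 by (simp add: log_mult)
  ultimately have "\<lfloor>log t y\<rfloor> - \<lfloor>log t x\<rfloor> \<in> {0, 1}" by simp linarith
  moreover have "\<lfloor>log t y\<rfloor> mod 2 = \<lfloor>log t x\<rfloor> mod 2"
    using same by (simp add: log_coloring_eq_iff t_def x_def y_def)
  ultimately have "\<lfloor>log t y\<rfloor> = \<lfloor>log t x\<rfloor>" by simp presburger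
  then show ?thesis by (simp add: t_def x_def y_def)
qed

text \<open>
  By the preceding lemma, \<open>n + b c\<close> and \<open>n + a c\<close> lie in one interval between consecutive powers
  of \<open>a/b\<close>, and likewise for \<open>n'\<close>. As \<open>n'\<close> exceeds \<open>n a/b\<close>, the point \<open>n' + a c\<close> is more than a
  factor \<open>a/b\<close> above \<open>n + b c\<close>, so the interval of \<open>n'\<close> comes strictly after that of \<open>n\<close>. This
  puts \<open>n' + b c\<close> above \<open>n + a c\<close>, which is impossible for \<open>c \<ge> n'\<close>.
\<close>
lemma no_large_common_shift:
  fixes a b n n' c :: int
  assumes ab: "0 < b" "b < a" and n: "n \<ge> 1" and n': "a * n < b * n'" and c: "c \<ge> n'"
    and same: "log_coloring (a / b) 2 (n + a * c) = log_coloring (a / b) 2 (n + b * c)"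
    and same': "log_coloring (a / b) 2 (n' + a * c) = log_coloring (a / b) 2 (n' + b * c)"
  shows False
proof -
  define t where "t = real_of_int a / real_of_int b"
  have t: "t > 1" and a: "real_of_int a = t * real_of_int b"
    using ab by (simp_all add: t_def)
  have "0 < a * n" using ab n by simp
  with n' have "0 < b * n'" by linarith
  then have n'1: "n' \<ge> 1" using ab by (simp add: zero_less_mult_iff)
  with c have c1: "c \<ge> 1" by simp
  define L where "L z = log t (real_of_int z)" for z :: int
  have k: "\<lfloor>L (n + a * c)\<rfloor> = \<lfloor>L (n + b * c)\<rfloor>" "\<lfloor>L (n' + a * c)\<rfloor> = \<lfloor>L (n' + b * c)\<rfloor>"
    using log_coloring_same_floor[OF ab n c1 same] log_coloring_same_floor[OF ab n'1 c1 same']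
    by (simp_all add: L_def t_def)
  have bc: "b * c > 0" "a * c > 0" using ab c1 by simp_all
  have "real_of_int (a * n) < real_of_int (b * n')" using n' by (simp only: of_int_less_iff)
  then have "real_of_int b * (t * n) < real_of_int b * n'" by (simp add: a algebra_simps)
  then have tn: "t * n < n'" using ab by simp
  have "t * real_of_int (n + b * c) < real_of_int (n' + a * c)"
    using tn by (simp add: a algebra_simps)
  moreover have pos: "0 < real_of_int (n + b * c)" "0 < real_of_int (n' + a * c)"
    "0 < real_of_int (n + a * c)" "0 < real_of_int (n' + b * c)"
    using bc n n'1 by linarith+
  ultimately have "log t (t * real_of_int (n + b * c)) < L (n' + a * c)"
    unfolding L_def using t by (subst log_less_cancel_iff) (simp_all del: of_int_add of_int_mult)
  then have "1 + L (n + b * c) < L (n' + a * c)"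
    using t pos(1) by (simp add: L_def log_mult del: of_int_add of_int_mult)
  then have "\<lfloor>L (n + b * c)\<rfloor> + 1 \<le> \<lfloor>L (n' + a * c)\<rfloor>" by linarith
  then have "\<lfloor>L (n + a * c)\<rfloor> + 1 \<le> \<lfloor>L (n' + b * c)\<rfloor>" using k by simp
  then have "L (n + a * c) < L (n' + b * c)" by linarith
  then have "n + a * c < n' + b * c"
    using t pos unfolding L_def
    by (subst (asm) log_less_cancel_iff) (simp_all only: of_int_less_iff of_int_0_less_iff)
  moreover have "(a - b) * c \<ge> 1 * c" using ab c1 by (intro mult_right_mono) auto
  ultimately show False using n c by (simp add: algebra_simps)
qed

lemma linear_two_coloring:
  fixes a b :: int
  assumes "0 < b" "b < a"
  shows "\<exists>\<phi>. is_coloring 2 \<phi> \<and> (\<forall>i. \<not> (\<exists>B C. B \<subseteq> posints \<and> C \<subseteq> posints \<and> infinite B \<and> infinite C \<and>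
    (\<forall>x \<in> (B + poly [:0, a:] ` C) \<union> (B + poly [:0, b:] ` C). \<phi> x = i)))"
proof -
  have unbounded: "\<exists>z\<in>Z. z > K" if "infinite Z" "Z \<subseteq> posints" for Z and K :: int
  proof (rule ccontr)
    assume "\<not> ?thesis"
    with that(2) have "Z \<subseteq> {1..K}" by (auto simp: posints_def not_less)
    with that(1) show False using finite_subset by blast
  qed
  let ?\<phi> = "log_coloring (a / b) 2"
  have False if B: "B \<subseteq> posints" "infinite B" and C: "C \<subseteq> posints" "infinite C"
    and mono: "\<forall>x \<in> (B + poly [:0, a:] ` C) \<union> (B + poly [:0, b:] ` C). ?\<phi> x = i" for B C i
  proof -
    have same: "?\<phi> (n + a * c) = ?\<phi> (n + b * c)" if "n \<in> B" "c \<in> C" for n c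
    proof -
      have "n + poly [:0, a:] c \<in> B + poly [:0, a:] ` C" "n + poly [:0, b:] c \<in> B + poly [:0, b:] ` C"
        using that by (blast intro: set_plus_intro)+
      then show ?thesis using mono by (simp add: mult.commute)
    qed
    obtain n where n: "n \<in> B" using unbounded[OF B(2,1)] by blast
    (* Since b >= 1, this gives a * n < b * n', that is, n' > n * (a / b). *)
    obtain n' where n': "n' \<in> B" "n' > a * n" using unbounded[OF B(2,1)] by blast
    obtain c where c: "c \<in> C" "c > n'" using unbounded[OF C(2,1)] by blast
    have "1 * n' \<le> b * n'" using assms n' B by (intro mult_right_mono) (auto simp: posints_def)
    with n' have "a * n < b * n'" by linarith
    then show False
      using no_large_common_shift[OF assms, of n n' c] same n n' c B by (auto simp: posints_def)
  qed
  then show ?thesis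
    by (intro exI[of _ ?\<phi>] conjI is_coloring_log_coloring) (simp, meson)
qed

section \<open>The three colorings\<close>

lemma degree_pos_if_zero_const:
  fixes P :: "int poly"
  assumes "lead_coeff P > 0" "coeff P 0 = 0"
  shows "degree P > 0"
  using assms by (metis gr0I less_irrefl)

lemma linear_poly_eq:
  fixes P :: "int poly"
  assumes "degree P = 1" "coeff P 0 = 0"
  shows "P = [:0, lead_coeff P:]"
  using assms by (metis degree1_coeffs coeff_pCons_0 coeff_pCons_Suc One_nat_def)

theorem proposition1p5:
  fixes P Q :: "int poly"
  assumes "lead_coeff P > 0" and "lead_coeff Q > 0"
    and "coeff P 0 = 0" and "coeff Q 0 = 0"
    and "P \<noteq> Q"
  shows
    "(max (degree P) (degree Q) > 1 \<longrightarrow>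
        (\<exists>\<phi>. is_coloring 2 \<phi> \<and>
          (\<forall>i\<in>{1..2}. \<forall>n\<in>posints. finite (mono_set \<phi> P Q n i)))) \<and>
     (degree P = 1 \<and> degree Q = 1 \<longrightarrow>
        (\<exists>\<phi>. is_coloring 3 \<phi> \<and>
          (\<forall>i\<in>{1..3}. \<forall>n\<in>posints. finite (mono_set \<phi> P Q n i)))) \<and>
     (degree P = 1 \<and> degree Q = 1 \<longrightarrow>
        (\<exists>\<phi>. is_coloring 2 \<phi> \<and>
          (\<forall>i\<in>{1..2}. \<not> (\<exists>B C. B \<subseteq> posints \<and> C \<subseteq> posints \<and> infinite B \<and> infinite C \<and>
             (\<forall>x \<in> (B + poly P ` C) \<union> (B + poly Q ` C). \<phi> x = i)))))"
proof -
  note lc = assms(1,2) and zc = assms(3,4)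
  have deg: "degree P > 0" "degree Q > 0"
    using degree_pos_if_zero_const lc zc by blast+
  have "lead_coeff (P - Q) \<noteq> 0" using \<open>P \<noteq> Q\<close>
    by (simp only: leading_coeff_0_iff right_minus_eq not_False_eq_True)
  then have dom: "lead_coeff (P - Q) > 0 \<or> lead_coeff (Q - P) > 0"
    by (metis degree_minus coeff_minus minus_diff_eq neg_0_less_iff_less linorder_neqE_linordered_idom)
  have part1: "\<exists>\<phi>. is_coloring 2 \<phi> \<and> (\<forall>n\<in>posints. \<forall>i. finite (mono_set \<phi> P Q n i))"
    if "max (degree P) (degree Q) > 1"
    using dom
  proof
    assume "lead_coeff (P - Q) > 0"
    from nonlinear_two_coloring[OF lc deg(2) that this] show ?thesis .
  next
    assume "lead_coeff (Q - P) > 0"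
    from nonlinear_two_coloring[OF lc(2,1) deg(1) _ this] that show ?thesis
      by (simp add: max.commute mono_set_commute[of _ Q P])
  qed
  define a where "a = lead_coeff P"
  define b where "b = lead_coeff Q"
  have ab: "0 < a" "0 < b" using lc by (simp_all add: a_def b_def)
  have linear_eq: "P = [:0, a:] \<and> Q = [:0, b:] \<and> a \<noteq> b" if "degree P = 1 \<and> degree Q = 1"
    using linear_poly_eq[of P] linear_poly_eq[of Q] that zc \<open>P \<noteq> Q\<close> unfolding a_def b_def by metis
  have part2: "\<exists>\<phi>. is_coloring 3 \<phi> \<and> (\<forall>n\<in>posints. \<forall>i. finite (mono_set \<phi> P Q n i))"
    if "degree P = 1 \<and> degree Q = 1"
  proof (cases "b < a")
    case True
    then show ?thesis using linear_three_coloring[of b a] ab linear_eq[OF that] by simp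
  next
    case False
    then show ?thesis using linear_three_coloring[of a b] ab linear_eq[OF that]
      by (simp add: mono_set_commute[of _ "[:0, a:]"])
  qed
  have part3: "\<exists>\<phi>. is_coloring 2 \<phi> \<and> (\<forall>i. \<not> (\<exists>B C. B \<subseteq> posints \<and> C \<subseteq> posints \<and>
      infinite B \<and> infinite C \<and> (\<forall>x \<in> (B + poly P ` C) \<union> (B + poly Q ` C). \<phi> x = i)))"
    if "degree P = 1 \<and> degree Q = 1"
  proof (cases "b < a")
    case True
    then show ?thesis using linear_two_coloring[of b a] ab linear_eq[OF that] by simp
  next
    case False
    then have "a < b" using linear_eq[OF that] by simp
    from linear_two_coloring[OF ab(1) this] linear_eq[OF that] show ?thesis
      by (subst Un_commute) simp
  qed
  show ?thesis
  proof (intro conjI impI)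
    assume "max (degree P) (degree Q) > 1"
    from part1[OF this] show "\<exists>\<phi>. is_coloring 2 \<phi> \<and>
        (\<forall>i\<in>{1..2}. \<forall>n\<in>posints. finite (mono_set \<phi> P Q n i))" by auto
  next
    assume "degree P = 1 \<and> degree Q = 1"
    from part2[OF this] show "\<exists>\<phi>. is_coloring 3 \<phi> \<and>
        (\<forall>i\<in>{1..3}. \<forall>n\<in>posints. finite (mono_set \<phi> P Q n i))" by auto
  next
    assume "degree P = 1 \<and> degree Q = 1"
    from part3[OF this] show "\<exists>\<phi>. is_coloring 2 \<phi> \<and>
        (\<forall>i\<in>{1..2}. \<not> (\<exists>B C. B \<subseteq> posints \<and> C \<subseteq> posints \<and> infinite B \<and> infinite C \<and>
           (\<forall>x \<in> (B + poly P ` C) \<union> (B + poly Q ` C). \<phi> x = i)))"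
      by (elim exE conjE) (rule exI, rule conjI, assumption, rule ballI, erule spec)
  qed
qed

end
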